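(* Let $U\in\mathrm{Eigen}(A)$. For all $k\in\mathrm{Pos}^s_\nu$, $$\mathbf{K}^{\rm lyap}_\nu\left(k,(UU^* )^{-1},t_Q^*((UU^* )^{-1})\right)=\mathbf{K}^{\rm diag}_{{\rm new},\nu}(k,U)\leq\mathbf{K}^{\rm diag}_\nu(k,U).$$
   Context: Data: $d\geq 1$, $A\in\mathbb{R}^{d\times d}$, $Q\in\mathbb{R}^{d\times d}$ symmetric, $q\in\mathbb{R}^d$, and $X^{\rm in}\subset\mathbb{R}^d$ a nonempty polytope (bounded). Standing assumptions: $0<\rho(A)<1$ ($\rho$ = spectral radius); $X^{\rm in}\neq\{0\}$; if $Q\preceq 0$ then $q\neq 0$. $\mathbb{N}$ contains $0$, $\mathbb{R}_+=[0,+\infty)$. $\mathrm{Eigen}(A)$ is the set of non-singular $U\in\mathbb{C}^{d\times d}$ for which there is a diagonal $D\in\mathbb{C}^{d\times d}$ with $A=UDU^{-1}$; it is assumed nonempty. For $k\in\mathbb{N}$, $\nu_k:=\max_{x\in X^{\rm in}}\left(x^\intercal (A^k)^\intercal Q A^k x+q^\intercal A^k x\right)$, and $\mathrm{Pos}^s_\nu:=\{k\in\mathbb{N}:\nu_k>0\}$. For Hermitian matrices, $B\succ0$ (resp. $B\succeq 0$) means positive definite (resp. semidefinite). $\mathcal{L}_A:=\{P\in\mathbb{C}^{d\times d}\text{ Hermitian}: P\succ 0,\ P-A^\intercal PA\succ 0\}$. For $P\succ 0$: $\|x\|_P:=\sqrt{x^*Px}$ on $\mathbb{C}^d$, $\|A\|_P:=\max_{x\neq0}\|Ax\|_P/\|x\|_P$,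 $\|y\|_P^*:=\sqrt{y^*P^{-1}y}$, $\mu(P):=\max_{x\in X^{\rm in}}x^\intercal Px$, $\mathcal{T}_Q(P):=\{t\in\mathbb{R}_+: tP-Q\succeq0\}$, and $t_Q^*(P):=\max\{\lambda_{\max}(P^{-1/2}QP^{-1/2}),0\}$. Let $\mathcal{L}(A,Q):=\{(P,t): P\in\mathcal{L}_A,\ t\in\mathcal{T}_Q(P)\}$. For $(P,t)\in\mathcal{L}(A,Q)$ and $x\in\mathbb{R}_+$, $H_{P,t}(x):=x\sqrt{\mu(P)}\,\|q\|_P^*$ if $t=0$, and $H_{P,t}(x):=\left(\sqrt{t\mu(P)}\,x+\frac{\|q\|_P^*}{2\sqrt t}\right)^2-\frac{(\|q\|_P^* )^2}{4t}$ if $t>0$. It is a strictly increasing homeomorphism of $\mathbb{R}_+$, with inverse $H_{P,t}^{-1}$. Standing assumption: $\nu_0<H_{P,t}(1)$ for all $(P,t)\in\mathcal{L}(A,Q)$. For $k\in\mathrm{Pos}^s_\nu$: $\mathbf{K}^{\rm lyap}_\nu(k,P,t):=\left\lfloor \frac{\ln\left(H_{P,t}^{-1}(\nu_k)\right)}{\ln\|A\|_P}\right\rfloor+1$ for $(P,t)\in\mathcal{L}(A,Q)$. For $U\in\mathrm{Eigen}(A)$, one has $(UU^* )^{-1}\in\mathcal{L}_A$, and $$\mathbf{K}^{\rm diag}_{{\rm new},\nu}(k,U):=\left\lfloor\frac{1}{\ln(\rho(A))}\ln\left(H^{-1}_{(UU^* )^{-1},\,t_Q^*((UU^* )^{-1})}(\nu_k)\right)\right\rfloor+1,$$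 $$\mathbf{K}^{\rm diag}_\nu(k,U):=\left\lfloor\frac{1}{\ln(\rho(A))}\ln\left(\frac{\sqrt{\nu_k+V_{\rm diag}^2}-V_{\rm diag}}{\sqrt{|\lambda_{\max}(U^*QU)|\,\mu((UU^* )^{-1})}}\right)\right\rfloor+1,\qquad V_{\rm diag}:=\frac{\|U^*q\|_2}{2\sqrt{|\lambda_{\max}(U^*QU)|}}.$$ The quantity $\mathbf{K}^{\rm diag}_\nu(k,U)$ is defined only when $\lambda_{\max}(U^*QU)\neq0$; the inequality involving it is understood in that case. *)

theory Defs
  imports "HOL-Analysis.Analysis"
begin

(* The maximum of a possibly infinite set of reals; "Max" is for finite sets only. Like every
   definite description, it is unspecified when no maximum is attained. *)
definition maximum :: "real set \<Rightarrow> real" where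
  "maximum S = (GREATEST m. m \<in> S)"

abbreviation cvec :: "real ^ 'n \<Rightarrow> complex ^ 'n" where
  "cvec x \<equiv> (\<chi> i. complex_of_real (x $ i))"

abbreviation cmat :: "real ^ 'n ^ 'm \<Rightarrow> complex ^ 'n ^ 'm" where
  "cmat M \<equiv> map_matrix complex_of_real M"

(* The instance of class power on matrices is entrywise, hence an explicit matrix power. *)
definition mpow :: "('a::semiring_1) ^ 'n ^ 'n \<Rightarrow> nat \<Rightarrow> 'a ^ 'n ^ 'n" where
  "mpow A k = ((**) A ^^ k) (mat 1)"

definition adjoint_mat :: "complex ^ 'n ^ 'm \<Rightarrow> complex ^ 'm ^ 'n" where
  "adjoint_mat M = map_matrix cnj (transpose M)"

definition hermitian :: "complex ^ 'n ^ 'n \<Rightarrow> bool" where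
  "hermitian M \<longleftrightarrow> adjoint_mat M = M"

(* x\<^sup>* M x. This is a real number for Hermitian M, the only case in which it is used, so that taking
   the real part is just the change of type. *)
definition qform :: "complex ^ 'n ^ 'n \<Rightarrow> complex ^ 'n \<Rightarrow> real" where
  "qform M x = Re (\<Sum>i\<in>UNIV. cnj (x $ i) * (M *v x) $ i)"

definition pos_def :: "complex ^ 'n ^ 'n \<Rightarrow> bool" where
  "pos_def M \<longleftrightarrow> hermitian M \<and> (\<forall>x. x \<noteq> 0 \<longrightarrow> qform M x > 0)"

definition pos_semidef :: "complex ^ 'n ^ 'n \<Rightarrow> bool" where
  "pos_semidef M \<longleftrightarrow> hermitian M \<and> (\<forall>x. qform M x \<ge> 0)"

definition eigenvalues :: "complex ^ 'n ^ 'n \<Rightarrow> complex set" where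
  "eigenvalues M = {z. \<exists>v. v \<noteq> 0 \<and> M *v v = z *s v}"

definition spectral_radius :: "complex ^ 'n ^ 'n \<Rightarrow> real" where
  "spectral_radius M = maximum (cmod ` eigenvalues M)"

(* Largest eigenvalue of a Hermitian matrix, all of whose eigenvalues are real. *)
definition lambda_max :: "complex ^ 'n ^ 'n \<Rightarrow> real" where
  "lambda_max M = maximum {r. complex_of_real r \<in> eigenvalues M}"

definition mat_sqrt :: "complex ^ 'n ^ 'n \<Rightarrow> complex ^ 'n ^ 'n" where
  "mat_sqrt P = (THE R. pos_semidef R \<and> R ** R = P)"

definition Eigen :: "real ^ 'n ^ 'n \<Rightarrow> (complex ^ 'n ^ 'n) set" where
  "Eigen A = {U. invertible U \<and>
     (\<exists>D. (\<forall>i j. i \<noteq> j \<longrightarrow> D $ i $ j = 0) \<and> cmat A = U ** D ** matrix_inv U)}"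

definition nu :: "real ^ 'n ^ 'n \<Rightarrow> real ^ 'n ^ 'n \<Rightarrow> real ^ 'n \<Rightarrow> (real ^ 'n) set \<Rightarrow> nat \<Rightarrow> real" where
  "nu A Q q X k =
     maximum ((\<lambda>x. x \<bullet> ((transpose (mpow A k) ** Q ** mpow A k) *v x) + q \<bullet> (mpow A k *v x)) ` X)"

definition Pos_s :: "(nat \<Rightarrow> real) \<Rightarrow> nat set" where
  "Pos_s u = {k. u k > 0}"

definition norm_P :: "complex ^ 'n ^ 'n \<Rightarrow> complex ^ 'n \<Rightarrow> real" where
  "norm_P P x = sqrt (qform P x)"

definition opnorm_P :: "complex ^ 'n ^ 'n \<Rightarrow> real ^ 'n ^ 'n \<Rightarrow> real" where
  "opnorm_P P A = maximum {norm_P P (cmat A *v x) / norm_P P x | x. x \<noteq> 0}"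

definition dual_norm_P :: "complex ^ 'n ^ 'n \<Rightarrow> complex ^ 'n \<Rightarrow> real" where
  "dual_norm_P P y = sqrt (qform (matrix_inv P) y)"

definition mu :: "(real ^ 'n) set \<Rightarrow> complex ^ 'n ^ 'n \<Rightarrow> real" where
  "mu X P = maximum ((\<lambda>x. qform P (cvec x)) ` X)"

definition Lyap :: "real ^ 'n ^ 'n \<Rightarrow> (complex ^ 'n ^ 'n) set" where
  "Lyap A = {P. pos_def P \<and> pos_def (P - cmat (transpose A) ** P ** cmat A)}"

definition T_Q :: "real ^ 'n ^ 'n \<Rightarrow> complex ^ 'n ^ 'n \<Rightarrow> real set" where
  "T_Q Q P = {t. t \<ge> 0 \<and> pos_semidef (t *\<^sub>R P - cmat Q)}"

definition t_star :: "real ^ 'n ^ 'n \<Rightarrow> complex ^ 'n ^ 'n \<Rightarrow> real" where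
  "t_star Q P =
     max (lambda_max (matrix_inv (mat_sqrt P) ** cmat Q ** matrix_inv (mat_sqrt P))) 0"

definition Lyap_T :: "real ^ 'n ^ 'n \<Rightarrow> real ^ 'n ^ 'n \<Rightarrow> ((complex ^ 'n ^ 'n) \<times> real) set" where
  "Lyap_T A Q = {(P, t). P \<in> Lyap A \<and> t \<in> T_Q Q P}"

definition H :: "real ^ 'n \<Rightarrow> (real ^ 'n) set \<Rightarrow> complex ^ 'n ^ 'n \<Rightarrow> real \<Rightarrow> real \<Rightarrow> real" where
  "H q X P t x =
     (if t = 0 then x * sqrt (mu X P) * dual_norm_P P (cvec q)
      else (sqrt (t * mu X P) * x + dual_norm_P P (cvec q) / (2 * sqrt t))\<^sup>2
             - (dual_norm_P P (cvec q))\<^sup>2 / (4 * t))"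

definition H_inv :: "real ^ 'n \<Rightarrow> (real ^ 'n) set \<Rightarrow> complex ^ 'n ^ 'n \<Rightarrow> real \<Rightarrow> real \<Rightarrow> real" where
  "H_inv q X P t = inv_into {0..} (H q X P t)"

definition K_lyap ::
  "real ^ 'n ^ 'n \<Rightarrow> real ^ 'n ^ 'n \<Rightarrow> real ^ 'n \<Rightarrow> (real ^ 'n) set \<Rightarrow>
   nat \<Rightarrow> complex ^ 'n ^ 'n \<Rightarrow> real \<Rightarrow> int" where
  "K_lyap A Q q X k P t = \<lfloor>ln (H_inv q X P t (nu A Q q X k)) / ln (opnorm_P P A)\<rfloor> + 1"

definition K_diag_new ::
  "real ^ 'n ^ 'n \<Rightarrow> real ^ 'n ^ 'n \<Rightarrow> real ^ 'n \<Rightarrow> (real ^ 'n) set \<Rightarrow>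
   nat \<Rightarrow> complex ^ 'n ^ 'n \<Rightarrow> int" where
  "K_diag_new A Q q X k U =
     (let P = matrix_inv (U ** adjoint_mat U)
      in \<lfloor>1 / ln (spectral_radius (cmat A)) * ln (H_inv q X P (t_star Q P) (nu A Q q X k))\<rfloor> + 1)"

definition V_diag ::
  "real ^ 'n ^ 'n \<Rightarrow> real ^ 'n \<Rightarrow> complex ^ 'n ^ 'n \<Rightarrow> real" where
  "V_diag Q q U =
     norm (adjoint_mat U *v cvec q) / (2 * sqrt \<bar>lambda_max (adjoint_mat U ** cmat Q ** U)\<bar>)"

(* Meaningful only if lambda_max (adjoint_mat U ** cmat Q ** U) is nonzero. *)
definition K_diag ::
  "real ^ 'n ^ 'n \<Rightarrow> real ^ 'n ^ 'n \<Rightarrow> real ^ 'n \<Rightarrow> (real ^ 'n) set \<Rightarrow>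
   nat \<Rightarrow> complex ^ 'n ^ 'n \<Rightarrow> int" where
  "K_diag A Q q X k U =
     \<lfloor>1 / ln (spectral_radius (cmat A)) *
       ln ((sqrt (nu A Q q X k + (V_diag Q q U)\<^sup>2) - V_diag Q q U) /
           sqrt (\<bar>lambda_max (adjoint_mat U ** cmat Q ** U)\<bar> *
                 mu X (matrix_inv (U ** adjoint_mat U))))\<rfloor> + 1"

end

theory Submission
  imports Defs
begin

text \<open>
  Write \<open>P = (U U\<^sup>*)\<inverse> = V\<^sup>* V\<close> with \<open>V = U\<inverse>\<close>. In the coordinates \<open>y = V x\<close> the \<open>P\<close>-norm is the
  Euclidean norm and \<open>A\<close> is the diagonal matrix \<open>D\<close>. Hence the operator norm of \<open>A\<close> with respect
  to \<open>P\<close> is the largest modulus of a diagonal entry of \<open>D\<close>, which is the spectral radius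
  (\<open>opnorm_matrix_inv_gram\<close>), and the first two bounds agree term by term.

  For the inequality, let \<open>l\<close> be the largest eigenvalue of \<open>U\<^sup>* Q U\<close>. The matrices \<open>U\<^sup>* Q U\<close> and
  \<open>P\<^bsup>-1/2\<^esup> Q P\<^bsup>-1/2\<^esup>\<close> are similar, so \<open>t_star Q P = max l 0\<close>
  (\<open>t_star_matrix_inv_gram\<close>). Both logarithms are divided by the negative number \<open>ln (\<rho> A)\<close>, so it
  suffices to compare their arguments (\<open>H_inv_matrix_inv_gram\<close>).

  \<^item> If \<open>l > 0\<close>, then solving the quadratic equation that defines the inverse of \<open>H\<close> gives exactly
    the argument in the old bound, and the two bounds are equal.
  \<^item> If \<open>l < 0\<close>, then \<open>t_star Q P = 0\<close> and \<open>H\<close> is linear. The matrix \<open>Q\<close> is then negative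
    semidefinite, so \<open>q \<noteq> 0\<close> and the slope of \<open>H\<close> is positive. The comparison of arguments becomes
    \<open>sqrt (\<nu> + v\<^sup>2) - v \<le> \<nu> / (2 v)\<close> for \<open>v = V_diag Q q U\<close>, a tangent estimate for the square root.

  Two facts of linear algebra carry this. The largest eigenvalue of a Hermitian matrix is the
  maximum of its Rayleigh quotient (\<open>hermitian_lambda_max\<close>). The matrix \<open>V\<^sup>* V\<close> has exactly one
  positive semidefinite square root when it is invertible (\<open>mat_sqrt_mult_self\<close>); existence comes
  from the polar decomposition of \<open>V\<close>, and uniqueness from the eigenvector that
  \<open>hermitian_lambda_max\<close> gives for the difference of two roots.
\<close>

section \<open>Maxima, adjoints and inverses\<close>

lemma maximum_eqI:
  assumes "m \<in> S" "\<And>s. s \<in> S \<Longrightarrow> s \<le> m"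
  shows "maximum S = m"
  unfolding maximum_def by (rule Greatest_equality) (use assms in auto)

lemma adjoint_mat_nth [simp]: "adjoint_mat M $ i $ j = cnj (M $ j $ i)"
  by (simp add: adjoint_mat_def transpose_def)

lemma adjoint_mat_adjoint [simp]: "adjoint_mat (adjoint_mat M) = M"
  by (simp add: vec_eq_iff)

lemma adjoint_mat_mult: "adjoint_mat (A ** B) = adjoint_mat B ** adjoint_mat A"
  by (simp add: vec_eq_iff matrix_matrix_mult_def mult.commute)

lemma adjoint_mat_one [simp]: "adjoint_mat (mat 1) = mat 1"
  by (simp add: vec_eq_iff mat_def)

lemma inner_complex_cnj: "x \<bullet> y = Re (cnj x * y)"
  by (simp add: inner_complex_def)

text \<open>
  The real part of the Hermitian product is the real inner product of \<open>complex ^ 'n\<close>. Hermitian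
  matrices are therefore the complex matrices that are self-adjoint for that real inner product,
  and all estimates below are made with it.
\<close>

lemma qform_inner: "qform M x = x \<bullet> (M *v x)"
  by (simp add: qform_def inner_vec_def inner_complex_cnj)

lemma adjoint_inner: "(M *v x) \<bullet> y = x \<bullet> (adjoint_mat M *v y)"
proof -
  have "(M *v x) \<bullet> y = (\<Sum>i\<in>UNIV. \<Sum>j\<in>UNIV. Re (cnj (M $ i $ j) * cnj (x $ j) * y $ i))"
    by (simp add: inner_vec_def inner_complex_cnj matrix_vector_mult_def sum_distrib_right
        del: complex_cnj_mult times_complex.sel) simp
  also have "\<dots> = (\<Sum>j\<in>UNIV. \<Sum>i\<in>UNIV. Re (cnj (M $ i $ j) * cnj (x $ j) * y $ i))"
    by (rule sum.swap)
  also have "\<dots> = x \<bullet> (adjoint_mat M *v y)"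
    by (simp add: inner_vec_def inner_complex_cnj matrix_vector_mult_def sum_distrib_left mult_ac
        del: times_complex.sel)
  finally show ?thesis .
qed

lemma qform_conj: "qform (adjoint_mat S ** M ** S) x = qform M (S *v x)"
  by (simp add: qform_inner adjoint_inner matrix_vector_mul_assoc matrix_mul_assoc)

lemma qform_adjoint_mult: "qform (adjoint_mat V ** V) x = (norm (V *v x))\<^sup>2"
  using qform_conj[of V "mat 1" x] by (simp add: qform_inner power2_norm_eq_inner)

lemma hermitian_iff_inner: "hermitian M \<longleftrightarrow> (\<forall>x y. (M *v x) \<bullet> y = x \<bullet> (M *v y))"
proof
  assume "\<forall>x y. (M *v x) \<bullet> y = x \<bullet> (M *v y)"
  then have "x \<bullet> (adjoint_mat M *v y - M *v y) = 0" for x y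
    by (simp add: adjoint_inner inner_diff_right)
  then have "adjoint_mat M *v y = M *v y" for y
    by (metis inner_eq_zero_iff right_minus_eq)
  then show "hermitian M"
    by (simp add: hermitian_def matrix_eq)
qed (simp add: adjoint_inner hermitian_def)

lemma hermitian_conj: "hermitian M \<Longrightarrow> hermitian (adjoint_mat S ** M ** S)"
  by (simp add: hermitian_def adjoint_mat_mult matrix_mul_assoc)

lemma matrix_add_rdistrib_ring:
  fixes A B :: "'a::ring_1 ^ 'n ^ 'm"
  shows "(A + B) ** C = A ** C + B ** C"
  by (simp add: vec_eq_iff matrix_matrix_mult_def distrib_right sum.distrib)

lemma matrix_vector_mult_scaleR_complex:
  fixes M :: "complex ^ 'n ^ 'm"
  shows "M *v (c *\<^sub>R x) = c *\<^sub>R (M *v x)"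
  by (simp add: linear_scale)

lemma scaleR_matrix_vector_mult:
  fixes M :: "complex ^ 'n ^ 'm"
  shows "(c *\<^sub>R M) *v x = c *\<^sub>R (M *v x)"
  by (simp add: matrix_vector_mult_def vec_eq_iff scaleR_sum_right)

lemma complex_scalar_eq_scaleR: "complex_of_real c *s x = c *\<^sub>R x"
  by (simp add: vec_eq_iff vector_scalar_mult_def) (simp add: scaleR_conv_of_real)

lemma matrix_inv_unique:
  fixes M :: "'a::field ^ 'n ^ 'n"
  assumes "M ** N = mat 1"
  shows "matrix_inv M = N"
proof -
  have inv: "N ** M = mat 1" using assms matrix_left_right_inverse by blast
  have "M ** matrix_inv M = mat 1 \<and> matrix_inv M ** M = mat 1"
    unfolding matrix_inv_def by (rule someI[of _ N]) (use assms inv in auto)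
  then show ?thesis by (metis inv matrix_mul_assoc matrix_mul_lid matrix_mul_rid)
qed

lemma matrix_inv_mult:
  fixes M :: "'a::field ^ 'n ^ 'n"
  assumes "invertible M"
  shows "M ** matrix_inv M = mat 1" and "matrix_inv M ** M = mat 1"
  using assms matrix_inv_unique by (auto simp: invertible_def)

section \<open>Semidefinite matrices and the largest eigenvalue\<close>

text \<open>
  A zero of a nonnegative form is a minimum, so the form cannot decrease along the direction
  \<open>w = M v\<close>; but its derivative at \<open>v\<close> in the direction \<open>-w\<close> is \<open>-2 \<parallel>w\<parallel>\<^sup>2\<close>.
\<close>

lemma pos_semidef_qform_zero:
  assumes "pos_semidef M" "qform M v = 0"
  shows "M *v v = 0"
proof -
  define w where "w = M *v v"
  define a where "a = w \<bullet> w"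
  define c where "c = qform M w"
  have herm: "v \<bullet> (M *v w) = a"
    using assms(1) unfolding pos_semidef_def hermitian_iff_inner a_def w_def by metis
  have "c \<ge> 0" using assms(1) by (simp add: pos_semidef_def c_def)
  have "a \<ge> 0" by (simp add: a_def)
  \<comment> \<open>The form at \<open>v + s w\<close> is \<open>2 s a + s\<^sup>2 c\<close>, minimal at \<open>s = - a / c\<close>; the shift by 1 also covers \<open>c = 0\<close>.\<close>
  define s where "s = - a / (c + 1)"
  have "0 \<le> qform M (v + s *\<^sub>R w)"
    using assms(1) by (simp add: pos_semidef_def)
  also have "\<dots> = 2 * s * a + s\<^sup>2 * c"
    using assms(2) herm
    by (simp add: qform_inner c_def algebra_simps matrix_vector_mult_scaleR_complex inner_add_left
        inner_add_right power2_eq_square a_def w_def[symmetric])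
  also have "\<dots> = - (a\<^sup>2 * (c + 2) / (c + 1)\<^sup>2)"
    using \<open>c \<ge> 0\<close> by (simp add: s_def divide_simps) (simp add: power2_eq_square algebra_simps)
  finally have "a\<^sup>2 * (c + 2) / (c + 1)\<^sup>2 \<le> 0" by simp
  then have "a\<^sup>2 \<le> 0"
    using \<open>c \<ge> 0\<close> by (simp add: divide_le_0_iff mult_le_0_iff)
  then show ?thesis by (simp add: a_def w_def)
qed

text \<open>
  The quadratic form attains its maximum \<open>m\<close> on the compact unit sphere, say at \<open>v\<close>. The matrix
  \<open>m I - M\<close> is positive semidefinite and its form vanishes at \<open>v\<close>, so it kills \<open>v\<close>: the maximum is
  an eigenvalue, and evaluating the form at any other eigenvector shows that it is the largest one.
\<close>

lemma hermitian_lambda_max: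
  assumes "hermitian M"
  shows "complex_of_real (lambda_max M) \<in> eigenvalues M"
    and "qform M x \<le> lambda_max M * (norm x)\<^sup>2"
proof -
  have "continuous_on (sphere 0 1) (qform M)"
    unfolding qform_inner by (intro continuous_intros linear_continuous_on
      matrix_vector_mul_linear linear_linear[THEN iffD2])
  moreover have "sphere (0::complex^'n) 1 \<noteq> {}" by simp
  ultimately obtain v where v: "norm v = 1" and max: "\<And>y. norm y = 1 \<Longrightarrow> qform M y \<le> qform M v"
    using continuous_attains_sup[OF compact_sphere, of 0 1 "qform M"] by auto
  define m where "m = qform M v"
  have bound: "qform M y \<le> m * (norm y)\<^sup>2" for y
  proof (cases "y = 0")
    case False
    have "qform M ((1 / norm y) *\<^sub>R y) \<le> m"
      using False by (simp add: m_def max)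
    then show ?thesis
      using False by (simp add: qform_inner matrix_vector_mult_scaleR_complex field_simps power2_eq_square)
  qed (simp add: qform_inner)
  have id: "(m *\<^sub>R mat 1) *v y = m *\<^sub>R y" for y :: "complex^'n"
    by (simp add: scaleR_matrix_vector_mult)
  have psd: "pos_semidef (m *\<^sub>R mat 1 - M)"
    unfolding pos_semidef_def using assms bound
    by (auto simp: hermitian_iff_inner matrix_vector_mult_diff_rdistrib id inner_diff_left
        inner_diff_right qform_inner power2_norm_eq_inner)
  have "qform (m *\<^sub>R mat 1 - M) v = m * (v \<bullet> v) - m"
    by (simp add: qform_inner matrix_vector_mult_diff_rdistrib id inner_diff_right)
      (simp add: m_def qform_inner)
  then have "qform (m *\<^sub>R mat 1 - M) v = 0"
    using v by (simp add: power2_norm_eq_inner[symmetric])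
  then have "M *v v = m *\<^sub>R v"
    using pos_semidef_qform_zero[OF psd] by (simp add: matrix_vector_mult_diff_rdistrib id)
  then have ev: "complex_of_real m \<in> eigenvalues M"
    using v by (auto simp: eigenvalues_def complex_scalar_eq_scaleR intro!: exI[of _ v])
  have "lambda_max M = m"
    unfolding lambda_max_def
  proof (rule maximum_eqI)
    fix r assume "r \<in> {r. complex_of_real r \<in> eigenvalues M}"
    then obtain y where "y \<noteq> 0" "M *v y = r *\<^sub>R y"
      by (auto simp: eigenvalues_def complex_scalar_eq_scaleR)
    then show "r \<le> m"
      using bound[of y] by (simp add: qform_inner power2_norm_eq_inner)
  qed (simp add: ev)
  then show "complex_of_real (lambda_max M) \<in> eigenvalues M"
    and "qform M x \<le> lambda_max M * (norm x)\<^sup>2"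
    using ev bound by auto
qed

lemma eigenvalues_similar_subset:
  assumes "invertible S" "S ** M = N ** S"
  shows "eigenvalues M \<subseteq> eigenvalues N"
proof
  fix z assume "z \<in> eigenvalues M"
  then obtain v where v: "v \<noteq> 0" "M *v v = z *s v" by (auto simp: eigenvalues_def)
  have "S *v v \<noteq> 0"
    using inj_matrix_vector_mult[OF assms(1)] v(1) by (metis injD matrix_vector_mult_0_right)
  moreover have "N *v (S *v v) = z *s (S *v v)"
    using assms(2) v(2) by (metis matrix_vector_mul_assoc vector_scalar_commute)
  ultimately show "z \<in> eigenvalues N" by (auto simp: eigenvalues_def)
qed

lemma eigenvalues_similar:
  assumes "invertible S" "S ** M = N ** S"
  shows "eigenvalues M = eigenvalues N"
proof
  obtain T where T: "S ** T = mat 1" "T ** S = mat 1"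
    using assms(1) by (auto simp: invertible_def)
  then have "T ** N = T ** (N ** S) ** T"
    by (metis matrix_mul_assoc matrix_mul_rid)
  then have "T ** N = M ** T"
    using T by (metis assms(2) matrix_mul_assoc matrix_mul_lid)
  moreover have "invertible T" using T by (auto simp: invertible_def)
  ultimately show "eigenvalues N \<subseteq> eigenvalues M" by (metis eigenvalues_similar_subset)
qed (rule eigenvalues_similar_subset[OF assms])

section \<open>Positive square roots\<close>

lemma compact_unitary: "compact {W :: complex ^ 'n ^ 'n. adjoint_mat W ** W = mat 1}"
proof -
  have "norm W \<le> real CARD('n) * real CARD('n)" if "adjoint_mat W ** W = mat 1" for W :: "complex^'n^'n"
  proof -
    have entry: "norm (W $ i $ j) \<le> 1" for i j
    proof -
      have "(\<Sum>i\<in>UNIV. cnj (W $ i $ j) * W $ i $ j) = 1"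
        using that by (simp add: vec_eq_iff matrix_matrix_mult_def mat_def)
      then have "complex_of_real (\<Sum>i\<in>UNIV. (norm (W $ i $ j))\<^sup>2) = 1"
        by (simp add: complex_norm_square mult.commute del: of_real_power)
      then have "(\<Sum>i\<in>UNIV. (norm (W $ i $ j))\<^sup>2) = 1"
        using of_real_eq_1_iff by blast
      then have "(norm (W $ i $ j))\<^sup>2 \<le> 1"
        using member_le_sum[of i UNIV "\<lambda>i. (norm (W $ i $ j))\<^sup>2"] by simp
      then show ?thesis by (simp add: abs_square_le_1)
    qed
    have "norm W \<le> (\<Sum>i\<in>UNIV. norm (W $ i))"
      unfolding norm_vec_def by (rule L2_set_le_sum) simp
    also have "\<dots> \<le> (\<Sum>i\<in>(UNIV::'n set). real CARD('n))"
    proof (rule sum_mono)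
      fix i
      have "norm (W $ i) \<le> (\<Sum>j\<in>UNIV. norm (W $ i $ j))"
        unfolding norm_vec_def[of "W $ i"] by (rule L2_set_le_sum) simp
      also have "\<dots> \<le> (\<Sum>j\<in>(UNIV::'n set). 1)" by (rule sum_mono) (rule entry)
      finally show "norm (W $ i) \<le> real CARD('n)" by simp
    qed
    finally show ?thesis by simp
  qed
  then have "bounded {W :: complex^'n^'n. adjoint_mat W ** W = mat 1}"
    unfolding bounded_iff by blast
  moreover have "closed {W :: complex^'n^'n. adjoint_mat W ** W = mat 1}"
  proof -
    have "{W :: complex^'n^'n. adjoint_mat W ** W = mat 1} =
        (\<Inter>i. \<Inter>j. {W. (\<Sum>k\<in>UNIV. cnj (W $ k $ i) * W $ k $ j) = mat 1 $ i $ j})"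
      by (auto simp: vec_eq_iff matrix_matrix_mult_def)
    also have "closed \<dots>"
      by (intro closed_INT ballI closed_Collect_eq continuous_intros)
    finally show ?thesis .
  qed
  ultimately show ?thesis by (simp add: compact_eq_bounded_closed)
qed

text \<open>
  The unitary \<open>Z = I + (u - 1) v v\<^sup>*\<close> multiplies the line of \<open>v\<close> by the phase \<open>u\<close> and fixes its
  orthogonal complement. The change of the trace isolates the single value \<open>v\<^sup>* R v\<close>, which is what
  makes these perturbations useful in maximising a trace over the unitary group.
\<close>

lemma unitary_rank_one_perturbation:
  fixes v :: "complex ^ 'n"
  assumes "norm v = 1" "norm u = 1"
  defines "Z \<equiv> mat 1 + (\<chi> i j. (u - 1) * v $ i * cnj (v $ j))"
  shows "adjoint_mat Z ** Z = mat 1"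
    and "trace (Z ** R) = trace R + (u - 1) * (\<Sum>j\<in>UNIV. cnj (v $ j) * (R *v v) $ j)"
proof -
  have v1: "(\<Sum>k\<in>UNIV. cnj (v $ k) * v $ k) = 1"
  proof -
    have "(\<Sum>k\<in>UNIV. cnj (v $ k) * v $ k) = complex_of_real (\<Sum>k\<in>UNIV. (norm (v $ k))\<^sup>2)"
      by (simp add: complex_norm_square mult.commute del: of_real_power)
    also have "(\<Sum>k\<in>UNIV. (norm (v $ k))\<^sup>2) = (norm v)\<^sup>2"
      by (simp add: norm_vec_def L2_set_def sum_nonneg)
    finally show ?thesis using assms(1) by simp
  qed
  have uu: "cnj u * u = 1"
    using assms(2) complex_norm_square[of u] by (simp add: mult.commute)
  show "adjoint_mat Z ** Z = mat 1"
  proof -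
    have E2: "(\<Sum>k\<in>UNIV. (v $ i * cnj (v $ k)) * (v $ k * cnj (v $ j))) = v $ i * cnj (v $ j)" for i j
    proof -
      have "(\<Sum>k\<in>UNIV. (v $ i * cnj (v $ k)) * (v $ k * cnj (v $ j)))
          = (\<Sum>k\<in>UNIV. cnj (v $ k) * v $ k) * (v $ i * cnj (v $ j))"
        by (simp add: sum_distrib_left sum_distrib_right mult_ac)
      then show ?thesis by (simp add: v1)
    qed
    \<comment> \<open>The multiples \<open>F c = c v v\<^sup>*\<close> of the projection onto \<open>v\<close> multiply like complex numbers.\<close>
    define F :: "complex \<Rightarrow> complex ^ 'n ^ 'n" where
      "F c = (\<chi> i j. c * (v $ i * cnj (v $ j)))" for c
    have FF: "F a ** F b = F (a * b)" for a b
    proof -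
      have "(F a ** F b) $ i $ j = F (a * b) $ i $ j" for i j
      proof -
        have "(F a ** F b) $ i $ j =
          a * b * (\<Sum>k\<in>UNIV. (v $ i * cnj (v $ k)) * (v $ k * cnj (v $ j)))"
          by (simp add: F_def matrix_matrix_mult_def sum_distrib_left mult_ac)
        then show ?thesis by (simp add: E2 F_def)
      qed
      then show ?thesis by (simp add: vec_eq_iff)
    qed
    have Fadd: "F a + F b = F (a + b)" for a b
      by (simp add: F_def vec_eq_iff algebra_simps)
    have Z: "Z = mat 1 + F (u - 1)" by (simp add: Z_def F_def mult.assoc)
    have Za: "adjoint_mat Z = mat 1 + F (cnj u - 1)"
      by (simp add: vec_eq_iff Z F_def mat_def)
    have "adjoint_mat Z ** Z = mat 1 + (F (u - 1) + (F (cnj u - 1) + F ((cnj u - 1) * (u - 1))))"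
      unfolding Za unfolding Z
      by (simp add: matrix_add_ldistrib matrix_add_rdistrib_ring FF add_ac)
    also have "\<dots> = mat 1 + F 0"
      unfolding Fadd using uu by (simp add: algebra_simps)
    finally show ?thesis by (simp add: F_def vec_eq_iff)
  qed
  have "trace (Z ** R) = trace R + (\<Sum>i\<in>UNIV. \<Sum>j\<in>UNIV. (u - 1) * v $ i * cnj (v $ j) * R $ j $ i)"
    by (simp add: Z_def matrix_add_rdistrib_ring trace_add) (simp add: trace_def matrix_matrix_mult_def)
  also have "(\<Sum>i\<in>UNIV. \<Sum>j\<in>UNIV. (u - 1) * v $ i * cnj (v $ j) * R $ j $ i) =
      (\<Sum>j\<in>UNIV. \<Sum>i\<in>UNIV. (u - 1) * v $ i * cnj (v $ j) * R $ j $ i)"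
    by (rule sum.swap)
  finally show "trace (Z ** R) = trace R + (u - 1) * (\<Sum>j\<in>UNIV. cnj (v $ j) * (R *v v) $ j)"
    by (simp add: matrix_vector_mult_def sum_distrib_left mult_ac)
qed

text \<open>Rotating \<open>c\<close> onto the positive axis gives \<open>\<bar>c\<bar> \<le> Re c\<close>.\<close>

lemma real_nonneg_if_rotation_max:
  assumes "\<And>u. norm u = 1 \<Longrightarrow> Re (u * c) \<le> Re c"
  shows "Im c = 0" "Re c \<ge> 0"
proof -
  have "cmod c \<le> Re c"
  proof (cases "c = 0")
    case False
    have "cnj c / cmod c * c = cmod c"
      using False complex_norm_square[of c] by (simp add: field_simps power2_eq_square)
    moreover have "norm (cnj c / cmod c) = 1" using False by (simp add: norm_divide)
    ultimately show ?thesis using assms by (metis Re_complex_of_real)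
  qed simp
  then have 1: "Re c \<ge> 0" "(cmod c)\<^sup>2 \<le> (Re c)\<^sup>2"
    using norm_ge_zero[of c] by (linarith, intro power_mono) auto
  then show "Re c \<ge> 0" by simp
  from 1(2) show "Im c = 0" by (simp add: cmod_power2)
qed

text \<open>
  Complex polarisation: that the form \<open>x\<^sup>* R x\<close> is real says that the real bilinear form
  \<open>(\<i> x) \<bullet> (R y)\<close> is alternating, hence antisymmetric, and replacing \<open>x\<close> by \<open>-\<i> x\<close> turns this into
  the symmetry of \<open>x \<bullet> (R y)\<close>.
\<close>

lemma pos_semidef_if_form_nonneg:
  fixes R :: "complex ^ 'n ^ 'n"
  assumes "\<And>x. Im (\<Sum>j\<in>UNIV. cnj (x $ j) * (R *v x) $ j) = 0"
    and "\<And>x. Re (\<Sum>j\<in>UNIV. cnj (x $ j) * (R *v x) $ j) \<ge> 0"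
  shows "pos_semidef R"
proof -
  have zero: "(\<i> *s x) \<bullet> (R *v x) = 0" for x
    using assms(1)[of x] by (simp add: inner_vec_def inner_complex_cnj algebra_simps)
  have anti: "(\<i> *s x) \<bullet> (R *v y) = - ((\<i> *s y) \<bullet> (R *v x))" for x y
    using zero[of "x + y"] zero[of x] zero[of y]
    by (simp add: algebra_simps vec.scale_right_distrib inner_add_left inner_add_right)
  have "x \<bullet> (R *v y) = (R *v x) \<bullet> y" for x y
  proof -
    have ii: "\<i> *s (- (\<i> *s x)) = x"
      by (simp add: vec_eq_iff vector_scalar_mult_def)
    have iso: "(\<i> *s a) \<bullet> (\<i> *s b) = a \<bullet> b" for a b :: "complex ^ 'n"
      by (simp add: inner_vec_def inner_complex_def algebra_simps)
    have "x \<bullet> (R *v y) = - ((\<i> *s y) \<bullet> (R *v (- (\<i> *s x))))"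
      using anti[of "- (\<i> *s x)" y] by (simp only: ii)
    also have "R *v (- (\<i> *s x)) = - (\<i> *s (R *v x))"
      by (simp add: vec.scale_minus_left[symmetric] vector_scalar_commute del: vec.scale_minus_left)
    finally show ?thesis by (simp add: iso inner_commute)
  qed
  then show ?thesis
    using assms(2) by (simp add: pos_semidef_def hermitian_iff_inner qform_def)
qed

text \<open>
  Polar decomposition by maximisation. Let \<open>W\<close> maximise \<open>Re (trace (W V))\<close> over the compact unitary
  group and put \<open>R = W V\<close>. Replacing \<open>W\<close> by \<open>Z W\<close> with \<open>Z = I + (u - 1) v v\<^sup>*\<close> cannot increase the
  trace, so \<open>Re (u c) \<le> Re c\<close> for \<open>c = v\<^sup>* R v\<close> and every phase \<open>u\<close>; thus \<open>c\<close> is real and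
  nonnegative. So \<open>R\<close> is positive semidefinite, and \<open>R R = R\<^sup>* R = V\<^sup>* W\<^sup>* W V = V\<^sup>* V\<close>.
\<close>

lemma pos_semidef_sqrt_exists:
  fixes V :: "complex ^ 'n ^ 'n"
  shows "\<exists>R. pos_semidef R \<and> R ** R = adjoint_mat V ** V"
proof -
  let ?S = "{W :: complex ^ 'n ^ 'n. adjoint_mat W ** W = mat 1}"
  have "continuous_on ?S (\<lambda>W. Re (trace (W ** V)))"
    unfolding trace_def matrix_matrix_mult_def by (simp, intro continuous_intros)
  moreover have "mat 1 \<in> ?S" by simp
  ultimately obtain W where W: "W \<in> ?S"
    and max: "\<And>Z. Z \<in> ?S \<Longrightarrow> Re (trace (Z ** V)) \<le> Re (trace (W ** V))"
    using continuous_attains_sup[OF compact_unitary, of "\<lambda>W. Re (trace (W ** V))"] by blast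
  define R where "R = W ** V"
  define c where "c x = (\<Sum>j\<in>UNIV. cnj (x $ j) * (R *v x) $ j)" for x
  have unit: "Im (c v) = 0" "Re (c v) \<ge> 0" if v: "norm v = 1" for v
  proof -
    have "Re (u * c v) \<le> Re (c v)" if u: "norm u = 1" for u
    proof -
      define Z where "Z = mat 1 + (\<chi> i j. (u - 1) * v $ i * cnj (v $ j))"
      note Z = unitary_rank_one_perturbation[OF v u, folded Z_def]
      have "adjoint_mat (Z ** W) ** (Z ** W) = adjoint_mat W ** (adjoint_mat Z ** Z) ** W"
        by (simp add: adjoint_mat_mult matrix_mul_assoc)
      then have "Z ** W \<in> ?S" using W Z(1) by simp
      then have "Re (trace (Z ** R)) \<le> Re (trace R)"
        using max by (simp add: R_def matrix_mul_assoc)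
      then have "Re ((u - 1) * c v) \<le> 0"
        by (simp add: Z(2) c_def del: times_complex.sel)
      then show ?thesis by (simp add: algebra_simps)
    qed
    then show "Im (c v) = 0" "Re (c v) \<ge> 0" using real_nonneg_if_rotation_max by blast+
  qed
  have scale: "c (r *\<^sub>R x) = r\<^sup>2 *\<^sub>R c x" for r x
    by (simp add: c_def matrix_vector_mult_scaleR_complex scaleR_right.sum power2_eq_square)
  have "Im (c x) = 0 \<and> Re (c x) \<ge> 0" for x
  proof (cases "x = 0")
    case False
    then have "x = norm x *\<^sub>R ((1 / norm x) *\<^sub>R x)" by simp
    then have "c x = (norm x)\<^sup>2 *\<^sub>R c ((1 / norm x) *\<^sub>R x)" by (metis scale)
    then show ?thesis
      using unit[of "(1 / norm x) *\<^sub>R x"] False by simp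
  qed (simp add: c_def)
  then have psd: "pos_semidef R"
    by (intro pos_semidef_if_form_nonneg) (simp_all add: c_def)
  then have "R ** R = adjoint_mat R ** R"
    by (simp add: pos_semidef_def hermitian_def)
  also have "\<dots> = adjoint_mat V ** (adjoint_mat W ** W) ** V"
    by (simp add: R_def adjoint_mat_mult matrix_mul_assoc)
  also have "\<dots> = adjoint_mat V ** V" using W by simp
  finally show ?thesis using psd by blast
qed

text \<open>
  If \<open>R\<^sup>2 = S\<^sup>2\<close> and \<open>T = R - S\<close>, then \<open>R T + T S = 0\<close>. Evaluated at an eigenvector \<open>v\<close> of \<open>T\<close> for its
  largest eigenvalue \<open>m\<close>, this says that \<open>m (v\<^sup>* R v + v\<^sup>* S v) = 0\<close>, and the bracket is positive as
  \<open>R\<close> is invertible. Hence \<open>m = 0\<close> and the form of \<open>T\<close> is nonpositive; exchanging \<open>R\<close> and \<open>S\<close> shows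
  that it vanishes, so \<open>T = 0\<close>.
\<close>

lemma pos_semidef_sqrt_unique:
  fixes R S :: "complex ^ 'n ^ 'n"
  assumes R: "pos_semidef R" and S: "pos_semidef S" and eq: "R ** R = S ** S"
    and inv: "invertible (R ** R)"
  shows "R = S"
proof -
  have diff: "hermitian (R - S)" if "pos_semidef R" "pos_semidef S" for R S :: "complex ^ 'n ^ 'n"
    using that by (simp add: pos_semidef_def hermitian_def vec_eq_iff)
  have nonpos: "qform (R - S) x \<le> 0"
    if R: "pos_semidef R" and S: "pos_semidef S" and eq: "R ** R = S ** S"
      and inv: "invertible (R ** R)" for R S :: "complex ^ 'n ^ 'n" and x
  proof -
    note herm = diff[OF R S]
    define m where "m = lambda_max (R - S)"
    obtain v where v: "v \<noteq> 0" "(R - S) *v v = m *\<^sub>R v"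
      using hermitian_lambda_max(1)[OF herm]
      by (auto simp: eigenvalues_def complex_scalar_eq_scaleR m_def)
    have Rv: "R *v v = S *v v + m *\<^sub>R v"
      using v(2) by (simp add: matrix_vector_mult_diff_rdistrib algebra_simps)
    have "R *v (R *v v) = R *v (S *v v + m *\<^sub>R v)" by (simp only: Rv)
    also have "\<dots> = R *v (S *v v) + m *\<^sub>R (R *v v)"
      by (simp only: matrix_vector_right_distrib matrix_vector_mult_scaleR_complex)
    finally have "S *v (S *v v) = R *v (S *v v) + m *\<^sub>R (R *v v)"
      using eq by (simp add: matrix_vector_mul_assoc)
    then have "v \<bullet> (S *v (S *v v)) = v \<bullet> (R *v (S *v v)) + m * qform R v"
      by (simp add: inner_add_right qform_inner)
    moreover have "v \<bullet> (R *v (S *v v)) = (R *v v) \<bullet> (S *v v)"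
      using R by (simp add: pos_semidef_def hermitian_iff_inner)
    moreover have "v \<bullet> (S *v (S *v v)) = (S *v v) \<bullet> (S *v v)"
      using S by (simp add: pos_semidef_def hermitian_iff_inner)
    moreover have "(R *v v) \<bullet> (S *v v) = (S *v v) \<bullet> (S *v v) + m * qform S v"
      by (simp add: Rv inner_add_left qform_inner)
    ultimately have "m * (qform R v + qform S v) = 0"
      by (simp add: distrib_left)
    moreover have "qform R v > 0"
    proof -
      have "R *v v \<noteq> 0"
        using inj_matrix_vector_mult[OF inv] v(1)
        by (metis injD matrix_vector_mul_assoc matrix_vector_mult_0_right)
      then show ?thesis
        using pos_semidef_qform_zero[OF R] R by (metis pos_semidef_def order_le_less)
    qed
    moreover have "qform S v \<ge> 0" using S by (simp add: pos_semidef_def)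
    ultimately have "m = 0" by auto
    then show ?thesis using hermitian_lambda_max(2)[OF herm, of x] by (simp add: m_def)
  qed
  have neg: "qform (S - R) x = - qform (R - S) x" for x
    by (simp add: qform_inner matrix_vector_mult_diff_rdistrib inner_diff_right)
  have zero: "qform (S - R) x = 0" for x
    using nonpos[OF R S eq inv, of x] nonpos[OF S R eq[symmetric], of x] inv neg[of x]
    by (simp add: eq)
  have "pos_semidef (S - R)"
    using diff[OF S R] zero by (simp add: pos_semidef_def)
  then have "(S - R) *v x = 0" for x
    using zero pos_semidef_qform_zero by blast
  then show ?thesis
    by (simp add: matrix_eq matrix_vector_mult_diff_rdistrib)
qed

lemma mat_sqrt_mult_self:
  fixes V :: "complex ^ 'n ^ 'n"
  assumes "invertible (adjoint_mat V ** V)"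
  defines "P \<equiv> adjoint_mat V ** V"
  shows "mat_sqrt P ** mat_sqrt P = P"
proof -
  obtain R where R: "pos_semidef R" "R ** R = P"
    using pos_semidef_sqrt_exists unfolding P_def by blast
  have "mat_sqrt P = R"
    unfolding mat_sqrt_def
  proof (rule the_equality)
    fix S assume "pos_semidef S \<and> S ** S = P"
    then show "S = R"
      using R assms by - (rule pos_semidef_sqrt_unique; simp)
  qed (use R in simp)
  then show ?thesis by (simp add: R)
qed

section \<open>The weight of a diagonalising basis\<close>

lemma matrix_inv_gram:
  fixes U :: "complex ^ 'n ^ 'n"
  assumes "invertible U"
  shows "matrix_inv (U ** adjoint_mat U) = adjoint_mat (matrix_inv U) ** matrix_inv U"
    and "matrix_inv (matrix_inv (U ** adjoint_mat U)) = U ** adjoint_mat U"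
    and "invertible (matrix_inv (U ** adjoint_mat U))"
proof -
  obtain V where V: "U ** V = mat 1" "V ** U = mat 1"
    using assms by (auto simp: invertible_def)
  have "U ** adjoint_mat U ** (adjoint_mat V ** V) = U ** adjoint_mat (V ** U) ** V"
    by (simp add: adjoint_mat_mult matrix_mul_assoc)
  also have "\<dots> = mat 1" using V by simp
  finally have right: "U ** adjoint_mat U ** (adjoint_mat V ** V) = mat 1" .
  then have left: "(adjoint_mat V ** V) ** (U ** adjoint_mat U) = mat 1"
    using matrix_left_right_inverse by blast
  show eq: "matrix_inv (U ** adjoint_mat U) = adjoint_mat (matrix_inv U) ** matrix_inv U"
    using matrix_inv_unique[OF right] matrix_inv_unique[OF V(1)] by simp
  show "matrix_inv (matrix_inv (U ** adjoint_mat U)) = U ** adjoint_mat U"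
    using matrix_inv_unique[OF right] matrix_inv_unique[OF left] by simp
  show "invertible (matrix_inv (U ** adjoint_mat U))"
    using matrix_inv_unique[OF right] left right by (auto simp: invertible_def)
qed

lemma qform_matrix_inv_gram:
  fixes U :: "complex ^ 'n ^ 'n"
  assumes "invertible U"
  shows "qform (matrix_inv (U ** adjoint_mat U)) x = (norm (matrix_inv U *v x))\<^sup>2"
  using assms by (simp add: matrix_inv_gram qform_adjoint_mult)

lemma dual_norm_matrix_inv_gram:
  fixes U :: "complex ^ 'n ^ 'n"
  assumes "invertible U"
  shows "dual_norm_P (matrix_inv (U ** adjoint_mat U)) y = norm (adjoint_mat U *v y)"
  using assms qform_adjoint_mult[of "adjoint_mat U" y]
  by (simp add: dual_norm_P_def matrix_inv_gram(2))

text \<open>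
  With \<open>R = P\<^bsup>1/2\<^esup>\<close>, the matrix \<open>S = U\<^sup>* R\<close> intertwines \<open>R\<inverse> Q R\<inverse>\<close> and \<open>U\<^sup>* Q U\<close>: both
  \<open>S R\<inverse> Q R\<inverse>\<close> and \<open>U\<^sup>* Q U S\<close> are \<open>U\<^sup>* Q R\<inverse>\<close>, the second one because
  \<open>U U\<^sup>* R = P\<inverse> R = R\<inverse>\<close>. So the two matrices have the same eigenvalues.
\<close>

lemma t_star_matrix_inv_gram:
  fixes U :: "complex ^ 'n ^ 'n"
  assumes "invertible U"
  shows "t_star Q (matrix_inv (U ** adjoint_mat U)) =
    max (lambda_max (adjoint_mat U ** cmat Q ** U)) 0"
proof -
  define P where "P = matrix_inv (U ** adjoint_mat U)"
  define R where "R = mat_sqrt P"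
  have RR: "R ** R = P"
    using mat_sqrt_mult_self[of "matrix_inv U"] matrix_inv_gram(1,3)[OF assms]
    by (simp add: P_def R_def)
  obtain P' where "P ** P' = mat 1"
    using matrix_inv_gram(3)[OF assms] by (auto simp: invertible_def P_def)
  then have "R ** (R ** P') = mat 1" by (simp add: RR matrix_mul_assoc)
  then have invR: "invertible R" by (auto simp: invertible_right_inverse)
  note Rinv = matrix_inv_mult[OF invR]
  have UUP: "U ** adjoint_mat U ** P = mat 1"
    using matrix_inv_mult(2)[OF matrix_inv_gram(3)[OF assms]] matrix_inv_gram(2)[OF assms]
    by (simp add: P_def)
  have invS: "invertible (adjoint_mat U ** R)"
  proof (rule invertible_mult[OF _ invR])
    obtain V where "V ** U = mat 1" using assms by (auto simp: invertible_def)
    then have "adjoint_mat U ** adjoint_mat V = mat 1" by (simp add: adjoint_mat_mult[symmetric])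
    then show "invertible (adjoint_mat U)" by (auto simp: invertible_right_inverse)
  qed
  have "adjoint_mat U ** R ** (matrix_inv R ** cmat Q ** matrix_inv R)
      = adjoint_mat U ** (R ** matrix_inv R) ** cmat Q ** matrix_inv R"
    by (simp add: matrix_mul_assoc)
  also have "\<dots> = adjoint_mat U ** cmat Q ** matrix_inv R"
    by (simp add: Rinv)
  also have "\<dots> = adjoint_mat U ** cmat Q ** (U ** adjoint_mat U ** P) ** matrix_inv R"
    by (simp add: UUP)
  also have "\<dots> = adjoint_mat U ** cmat Q ** U ** adjoint_mat U ** R ** (R ** matrix_inv R)"
    by (simp add: matrix_mul_assoc RR[symmetric])
  also have "\<dots> = adjoint_mat U ** cmat Q ** U ** (adjoint_mat U ** R)"
    by (simp add: Rinv matrix_mul_assoc)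
  finally have "eigenvalues (matrix_inv R ** cmat Q ** matrix_inv R) =
      eigenvalues (adjoint_mat U ** cmat Q ** U)"
    by (rule eigenvalues_similar[OF invS])
  then show ?thesis by (simp add: t_star_def lambda_max_def P_def R_def)
qed

text \<open>
  The substitution \<open>y = V x\<close> turns the quotient of \<open>P\<close>-norms into \<open>\<parallel>D y\<parallel> / \<parallel>y\<parallel>\<close>. Its maximum is the
  largest \<open>\<bar>D\<^sub>i\<^sub>i\<bar>\<close>, attained at a coordinate vector, and the \<open>D\<^sub>i\<^sub>i\<close> are the eigenvalues of \<open>A\<close>.
\<close>

lemma opnorm_matrix_inv_gram:
  fixes A :: "real ^ 'n ^ 'n"
  assumes "U \<in> Eigen A"
  shows "opnorm_P (matrix_inv (U ** adjoint_mat U)) A = spectral_radius (cmat A)"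
proof -
  obtain D where inv: "invertible U" and diag: "\<And>i j. i \<noteq> j \<Longrightarrow> D $ i $ j = 0"
    and A: "cmat A = U ** D ** matrix_inv U"
    using assms by (auto simp: Eigen_def)
  define V where "V = matrix_inv U"
  have UV: "U ** V = mat 1" "V ** U = mat 1"
    using matrix_inv_mult[OF inv] by (simp_all add: V_def)
  have Dv: "(D *v y) $ i = D $ i $ i * y $ i" for y i
  proof -
    have "(D *v y) $ i = (\<Sum>j\<in>UNIV. if j = i then D $ i $ i * y $ i else 0)"
      unfolding matrix_vector_mult_def vec_lambda_beta
      by (rule sum.cong) (auto simp: diag)
    then show ?thesis by simp
  qed
  define d where "d = Max (range (\<lambda>i. norm (D $ i $ i)))"
  have "d \<in> range (\<lambda>i. norm (D $ i $ i))" unfolding d_def by (rule Max_in) simp_all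
  then obtain j where "d = norm (D $ j $ j)" by blast
  moreover have "norm (D $ i $ i) \<le> d" for i
    unfolding d_def by (rule Max_ge) simp_all
  ultimately have j: "norm (D $ i $ i) \<le> norm (D $ j $ j)" for i by metis
  have axis: "D *v axis j 1 = D $ j $ j *s axis j 1"
    by (simp add: vec_eq_iff Dv) (simp add: axis_def)
  have axis0: "axis j (1::complex) \<noteq> 0" by (simp add: axis_eq_0_iff)
  have VA: "V ** cmat A = D ** V"
    by (simp add: A matrix_mul_assoc UV V_def[symmetric])
  have "invertible V" using UV by (auto simp: invertible_def)
  then have eig: "eigenvalues (cmat A) = eigenvalues D"
    using VA by (rule eigenvalues_similar)
  have "spectral_radius (cmat A) = norm (D $ j $ j)"
    unfolding spectral_radius_def eig
  proof (rule maximum_eqI)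
    show "norm (D $ j $ j) \<in> cmod ` eigenvalues D"
      using axis axis0 unfolding eigenvalues_def by blast
    fix s assume "s \<in> cmod ` eigenvalues D"
    then obtain z y where s: "s = cmod z" and y: "y \<noteq> 0" "D *v y = z *s y"
      by (auto simp: eigenvalues_def)
    then obtain i where "y $ i \<noteq> 0" by (auto simp: vec_eq_iff)
    moreover have "D $ i $ i * y $ i = z * y $ i" using y(2) Dv by (metis vector_smult_component)
    ultimately show "s \<le> norm (D $ j $ j)" using j[of i] s by simp
  qed
  moreover have "opnorm_P (matrix_inv (U ** adjoint_mat U)) A = norm (D $ j $ j)"
    unfolding opnorm_P_def
  proof (rule maximum_eqI)
    have normP: "norm_P (matrix_inv (U ** adjoint_mat U)) x = norm (V *v x)" for x
      by (simp add: norm_P_def qform_matrix_inv_gram[OF inv] V_def)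
    have VAx: "V *v (cmat A *v x) = D *v (V *v x)" for x
      by (simp add: matrix_vector_mul_assoc VA)
    have VUx: "V *v (U *v x) = x" for x
      by (simp add: matrix_vector_mul_assoc UV)
    have "D *v axis j 1 = axis j (D $ j $ j)"
      unfolding axis by (simp add: vec_eq_iff axis_def)
    then have "norm (D *v (V *v (U *v axis j 1))) / norm (V *v (U *v axis j 1)) = norm (D $ j $ j)"
      by (simp add: VUx norm_eq_sqrt_inner inner_axis_axis)
    moreover have "U *v axis j 1 \<noteq> 0" using VUx axis0 by (metis matrix_vector_mult_0_right)
    ultimately show "norm (D $ j $ j) \<in>
        {norm_P (matrix_inv (U ** adjoint_mat U)) (cmat A *v x) /
         norm_P (matrix_inv (U ** adjoint_mat U)) x | x. x \<noteq> 0}"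
      unfolding normP VAx by (metis (mono_tags, lifting) mem_Collect_eq)
    have bound: "norm (D *v y) \<le> norm (D $ j $ j) * norm y" for y
    proof -
      have "norm (D *v y) \<le> L2_set (\<lambda>i. norm (D $ j $ j) * norm (y $ i)) UNIV"
        unfolding norm_vec_def[of "D *v y"]
        by (rule L2_set_mono) (auto simp: Dv norm_mult intro!: mult_right_mono j)
      then show ?thesis by (simp add: L2_set_right_distrib norm_vec_def[of y])
    qed
    fix s assume "s \<in> {norm_P (matrix_inv (U ** adjoint_mat U)) (cmat A *v x) /
        norm_P (matrix_inv (U ** adjoint_mat U)) x | x. x \<noteq> 0}"
    then obtain x where "x \<noteq> 0" and s: "s = norm (D *v (V *v x)) / norm (V *v x)"
      by (auto simp: normP VAx)
    then show "s \<le> norm (D $ j $ j)"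
      using bound[of "V *v x"] by (cases "V *v x = 0") (simp_all add: divide_le_eq)
  qed
  ultimately show ?thesis by simp
qed

lemma mu_matrix_inv_gram_pos:
  fixes X :: "(real ^ 'n) set" and U :: "complex ^ 'n ^ 'n"
  assumes "invertible U" "compact X" "X \<noteq> {}" "X \<noteq> {0}"
  shows "mu X (matrix_inv (U ** adjoint_mat U)) > 0"
proof -
  let ?f = "\<lambda>x. qform (matrix_inv (U ** adjoint_mat U)) (cvec x)"
  have "continuous_on X ?f"
    unfolding qform_def matrix_vector_mult_def by (simp, intro continuous_intros)
  then obtain x where x: "x \<in> X" "\<And>y. y \<in> X \<Longrightarrow> ?f y \<le> ?f x"
    using continuous_attains_sup[OF assms(2,3)] by blast
  have mu: "mu X (matrix_inv (U ** adjoint_mat U)) = ?f x"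
    unfolding mu_def by (rule maximum_eqI) (use x in auto)
  obtain y where y: "y \<in> X" "y \<noteq> 0" using assms(3,4) by blast
  then have "cvec y \<noteq> 0" by (auto simp: vec_eq_iff)
  moreover have "U *v (matrix_inv U *v cvec y) = cvec y"
    by (simp add: matrix_vector_mul_assoc matrix_inv_mult[OF assms(1)])
  ultimately have "matrix_inv U *v cvec y \<noteq> 0" by auto
  then have "?f y > 0" using assms(1) by (simp add: qform_matrix_inv_gram)
  then show ?thesis using x(2)[OF y(1)] mu by simp
qed

section \<open>Inverting the threshold function\<close>

text \<open>
  Since \<open>H_inv\<close> picks an arbitrary preimage in \<open>[0,\<infinity>)\<close>, evaluating it needs a preimage and its
  uniqueness there.
\<close>

lemma H_inv_eqI:
  assumes "H q X P t x = y" "x \<ge> 0" "\<And>z. z \<ge> 0 \<Longrightarrow> H q X P t z = y \<Longrightarrow> z = x"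
  shows "H_inv q X P t y = x"
proof -
  have "y \<in> H q X P t ` {0..}" using assms(1,2) by auto
  then have "H q X P t (H_inv q X P t y) = y" "H_inv q X P t y \<in> {0..}"
    unfolding H_inv_def by (rule f_inv_into_f, rule inv_into_into)
  then show ?thesis using assms(3) by simp
qed

lemma H_inv_of_pos:
  assumes "t > 0" "mu X P > 0" "y \<ge> 0" "dual_norm_P P (cvec q) \<ge> 0"
  defines "V \<equiv> dual_norm_P P (cvec q) / (2 * sqrt t)"
  shows "H_inv q X P t y = (sqrt (y + V\<^sup>2) - V) / sqrt (t * mu X P)"
proof -
  define s where "s = sqrt (t * mu X P)"
  have "s > 0" using assms by (simp add: s_def)
  have "V \<ge> 0" using assms by (simp add: V_def)
  have H: "H q X P t z = (s * z + V)\<^sup>2 - V\<^sup>2" for z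
    using assms(1) by (simp add: H_def s_def V_def power_divide power_mult_distrib)
  show ?thesis unfolding s_def[symmetric]
  proof (rule H_inv_eqI)
    show "H q X P t ((sqrt (y + V\<^sup>2) - V) / s) = y"
      using \<open>s > 0\<close> \<open>y \<ge> 0\<close> by (simp add: H)
    have "V \<le> sqrt (y + V\<^sup>2)"
      using \<open>y \<ge> 0\<close> by (intro real_le_rsqrt) simp
    then show "(sqrt (y + V\<^sup>2) - V) / s \<ge> 0" using \<open>s > 0\<close> by simp
    fix z assume "z \<ge> 0" "H q X P t z = y"
    then have "sqrt (y + V\<^sup>2) = s * z + V"
      using \<open>s > 0\<close> \<open>V \<ge> 0\<close> by (intro real_sqrt_unique) (auto simp: H)
    then show "z = (sqrt (y + V\<^sup>2) - V) / s" using \<open>s > 0\<close> by simp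
  qed
qed

lemma H_inv_of_zero:
  assumes "mu X P > 0" "y \<ge> 0" "dual_norm_P P (cvec q) > 0"
  shows "H_inv q X P 0 y = y / (sqrt (mu X P) * dual_norm_P P (cvec q))"
  by (rule H_inv_eqI) (use assms in \<open>auto simp: H_def field_simps\<close>)

lemma sqrt_add_square_minus_le:
  fixes V y :: real
  assumes "V > 0" "y \<ge> 0"
  shows "sqrt (y + V\<^sup>2) - V \<le> y / (2 * V)"
proof -
  have "sqrt (y + V\<^sup>2) \<le> y / (2 * V) + V"
  proof (rule real_le_lsqrt)
    have "(y / (2 * V) + V)\<^sup>2 = (y / (2 * V))\<^sup>2 + y + V\<^sup>2"
      using assms by (simp add: power2_sum)
    then show "y + V\<^sup>2 \<le> (y / (2 * V) + V)\<^sup>2" by simp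
  qed (use assms in auto)
  then show ?thesis by simp
qed

section \<open>The comparison\<close>

text \<open>
  The number \<open>a\<close> is the argument of the logarithm in \<open>K_diag\<close>, at the value \<open>y\<close> of \<open>\<nu>\<^sub>k\<close>. It is
  positive, so that the logarithm is monotone where it is applied.
\<close>

lemma H_inv_matrix_inv_gram:
  fixes Q :: "real ^ 'n ^ 'n" and U :: "complex ^ 'n ^ 'n"
  assumes "transpose Q = Q" and "pos_semidef (- cmat Q) \<longrightarrow> q \<noteq> 0"
    and "invertible U" and "mu X (matrix_inv (U ** adjoint_mat U)) > 0" and "y > 0"
  defines "P \<equiv> matrix_inv (U ** adjoint_mat U)"
    and "l \<equiv> lambda_max (adjoint_mat U ** cmat Q ** U)"
  assumes "l \<noteq> 0"
  defines "a \<equiv> (sqrt (y + (V_diag Q q U)\<^sup>2) - V_diag Q q U) / sqrt (\<bar>l\<bar> * mu X P)"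
  shows "0 < a" and "a \<le> H_inv q X P (t_star Q P) y"
proof -
  define d where "d = norm (adjoint_mat U *v cvec q)"
  have dual: "dual_norm_P P (cvec q) = d"
    using assms(3) by (simp add: P_def d_def dual_norm_matrix_inv_gram)
  have mu: "mu X P > 0" using assms(4) by (simp add: P_def)
  have V: "V_diag Q q U = d / (2 * sqrt \<bar>l\<bar>)" by (simp add: V_diag_def d_def l_def)
  have t: "t_star Q P = max l 0" using assms(3) by (simp add: P_def l_def t_star_matrix_inv_gram)
  have "d \<ge> 0" by (simp add: d_def)
  have "V_diag Q q U \<ge> 0" by (simp add: V \<open>d \<ge> 0\<close>)
  then have "V_diag Q q U < sqrt (y + (V_diag Q q U)\<^sup>2)"
    using \<open>y > 0\<close> by (intro real_less_rsqrt) simp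
  then show "0 < a" using mu \<open>l \<noteq> 0\<close> by (simp add: a_def)
  show "a \<le> H_inv q X P (t_star Q P) y"
  proof (cases "l > 0")
    case True
    then show ?thesis
      using H_inv_of_pos[of l X P y q] mu \<open>y > 0\<close> \<open>d \<ge> 0\<close> by (simp add: t dual a_def V)
  next
    case False
    then have "l < 0" using \<open>l \<noteq> 0\<close> by simp
    \<comment> \<open>The form of \<open>Q\<close> is that of \<open>U\<^sup>* Q U\<close> in the coordinates \<open>W x\<close>, hence nonpositive;
        the hypothesis on \<open>q\<close> then gives a positive slope \<open>d\<close>.\<close>
    have hQ: "hermitian (cmat Q)"
      using assms(1) by (simp add: hermitian_def vec_eq_iff transpose_def)
    obtain W where W: "U ** W = mat 1" "W ** U = mat 1"
      using assms(3) by (auto simp: invertible_def)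
    have "qform (cmat Q) x \<le> 0" for x
    proof -
      have "qform (cmat Q) x = qform (adjoint_mat U ** cmat Q ** U) (W *v x)"
        by (simp add: qform_conj matrix_vector_mul_assoc W)
      also have "\<dots> \<le> l * (norm (W *v x))\<^sup>2"
        unfolding l_def by (rule hermitian_lambda_max(2)[OF hermitian_conj[OF hQ]])
      also have "\<dots> \<le> 0" using \<open>l < 0\<close> by (simp add: mult_nonpos_nonneg)
      finally show ?thesis .
    qed
    moreover have "(- cmat Q) *v x = - (cmat Q *v x)" for x
      using matrix_vector_mult_diff_rdistrib[of 0 "cmat Q" x] by simp
    ultimately have "pos_semidef (- cmat Q)"
      using hQ by (simp add: pos_semidef_def hermitian_iff_inner qform_inner)
    then have "q \<noteq> 0" using assms(2) by blast
    then have "cvec q \<noteq> 0" by (auto simp: vec_eq_iff)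
    moreover have "adjoint_mat W *v (adjoint_mat U *v cvec q) = cvec q"
      by (simp add: matrix_vector_mul_assoc adjoint_mat_mult[symmetric] W)
    ultimately have "d > 0" unfolding d_def by (metis matrix_vector_mult_0_right zero_less_norm_iff)
    then have "V_diag Q q U > 0" using \<open>l < 0\<close> by (simp add: V)
    then have "sqrt (y + (V_diag Q q U)\<^sup>2) - V_diag Q q U \<le> y / (2 * V_diag Q q U)"
      using sqrt_add_square_minus_le \<open>y > 0\<close> by simp
    then have "a \<le> y / (2 * V_diag Q q U) / sqrt (\<bar>l\<bar> * mu X P)"
      unfolding a_def using mu by (intro divide_right_mono) auto
    also have "\<dots> = y / (sqrt (mu X P) * d)"
    proof -
      define r where "r = sqrt \<bar>l\<bar>"
      have "r > 0" using \<open>l < 0\<close> by (simp add: r_def)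
      then show ?thesis
        unfolding V real_sqrt_mult r_def[symmetric] by (simp add: field_simps)
    qed
    also have "\<dots> = H_inv q X P (t_star Q P) y"
      using H_inv_of_zero[of X P y q] mu \<open>y > 0\<close> \<open>d > 0\<close> \<open>l < 0\<close> by (simp add: t dual)
    finally show ?thesis .
  qed
qed

theorem theorem6:
  fixes A Q :: "real ^ 'n ^ 'n" and q :: "real ^ 'n" and X :: "(real ^ 'n) set"
    and U :: "complex ^ 'n ^ 'n" and k :: nat
  assumes "transpose Q = Q"
    and "polytope X" and "X \<noteq> {}" and "X \<noteq> {0}"
    and "0 < spectral_radius (cmat A)" and "spectral_radius (cmat A) < 1"
    and "pos_semidef (- cmat Q) \<longrightarrow> q \<noteq> 0"
    and "\<forall>(P, t) \<in> Lyap_T A Q. nu A Q q X 0 < H q X P t 1"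
    and "U \<in> Eigen A"
    and "k \<in> Pos_s (nu A Q q X)"
  shows "K_lyap A Q q X k (matrix_inv (U ** adjoint_mat U))
             (t_star Q (matrix_inv (U ** adjoint_mat U))) = K_diag_new A Q q X k U
         \<and> (lambda_max (adjoint_mat U ** cmat Q ** U) \<noteq> 0
              \<longrightarrow> K_diag_new A Q q X k U \<le> K_diag A Q q X k U)"
proof (intro conjI impI)
  show "K_lyap A Q q X k (matrix_inv (U ** adjoint_mat U))
      (t_star Q (matrix_inv (U ** adjoint_mat U))) = K_diag_new A Q q X k U"
    using assms(9) by (simp add: K_lyap_def K_diag_new_def Let_def opnorm_matrix_inv_gram)
next
  assume l: "lambda_max (adjoint_mat U ** cmat Q ** U) \<noteq> 0"
  have inv: "invertible U" using assms(9) by (simp add: Eigen_def)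
  have mu: "mu X (matrix_inv (U ** adjoint_mat U)) > 0"
    using mu_matrix_inv_gram_pos[OF inv polytope_imp_compact] assms(2-4) by blast
  have "nu A Q q X k > 0" using assms(10) by (simp add: Pos_s_def)
  note a = H_inv_matrix_inv_gram[OF assms(1,7) inv mu this l]
  have "1 / ln (spectral_radius (cmat A)) \<le> 0"
    using assms(5,6) by (simp add: ln_less_zero divide_nonneg_neg less_imp_le)
  then show "K_diag_new A Q q X k U \<le> K_diag A Q q X k U"
    unfolding K_diag_new_def K_diag_def Let_def
    using a by (intro add_right_mono floor_mono mult_left_mono_neg) (simp_all add: ln_mono)
qed

end
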